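(* Let $0<q<1$ be fixed and let $c\geq0$. Let $a_q=(q-1-\ln q)/(\ln q)^2$. The function $$g_{q,c}(x)=\psi_q(x)-\ln\frac{1-q^x}{1-q}+a_q\psi_q'(x+c)$$ is completely monotonic on $(0,+\infty)$ if and only if $c=0$.
   Context: For $0<q<1$ and $x>0$, the $q$-gamma function is $$\Gamma_q(x)=\frac{(q;q)_\infty}{(q^x;q)_\infty}(1-q)^{1-x},\qquad (a;q)_\infty=\prod_{n=0}^\infty(1-aq^n),$$ and $\psi_q=\Gamma_q'/\Gamma_q$ is its logarithmic derivative on $(0,+\infty)$. A function $f$ is completely monotonic on $(a,b)$ if it has derivatives of all orders there and $(-1)^kf^{(k)}(x)\geq0$ for all $x\in(a,b)$ and all integers $k\geq0$. *)

theory Defs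
  imports "HOL-Analysis.Analysis"
begin

definition qpochhammer_inf :: "real \<Rightarrow> real \<Rightarrow> real" where
  "qpochhammer_inf a q = (\<Prod>n. 1 - a * q ^ n)"

definition qGamma :: "real \<Rightarrow> real \<Rightarrow> real" where
  "qGamma q x =
     qpochhammer_inf q q / qpochhammer_inf (q powr x) q * (1 - q) powr (1 - x)"

definition qDigamma :: "real \<Rightarrow> real \<Rightarrow> real" where
  "qDigamma q x = deriv (qGamma q) x / qGamma q x"

definition aq :: "real \<Rightarrow> real" where
  "aq q = (q - 1 - ln q) / (ln q)\<^sup>2"

definition gq :: "real \<Rightarrow> real \<Rightarrow> real \<Rightarrow> real" where
  "gq q c x =
     qDigamma q x - ln ((1 - q powr x) / (1 - q)) + aq q * deriv (qDigamma q) (x + c)"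

(* Intended for open S only: deriv is the derivative at a point of the whole real line.
   As deriv is total, the existence of the (k+1)-st derivative is required explicitly. *)
definition completely_monotonic_on :: "real set \<Rightarrow> (real \<Rightarrow> real) \<Rightarrow> bool" where
  "completely_monotonic_on S f \<longleftrightarrow>
     (\<forall>k. \<forall>x\<in>S. (deriv ^^ k) f differentiable (at x) \<and> (-1) ^ k * (deriv ^^ k) f x \<ge> 0)"

end

theory Submission
  imports Defs
begin

text \<open>
  With \<open>t = - ln q\<close>, all functions involved are power series in \<open>y = q\<^sup>x\<close>: one has
  \<open>g\<^sub>q\<^sub>,\<^sub>c(x) = \<Sum>\<^sub>k C\<^sub>k y\<^sup>k\<close> with
  \<open>C\<^sub>k = 1/k - t/(1 - q\<^sup>k) + (q - 1 + t) k q\<^sup>k\<^sup>c/(1 - q\<^sup>k)\<close>. Each derivative in \<open>x\<close>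
  multiplies the \<open>k\<close>-th coefficient by \<open>-t k\<close>, so nonnegative coefficients give complete
  monotonicity. For \<open>c = 0\<close> nonnegativity amounts to
  \<open>q\<^sup>k - 1 + t k \<le> k\<^sup>2 (q - 1 + t)\<close>. For \<open>c > 0\<close> the coefficient \<open>C\<^sub>1\<close> is negative, and it
  dominates as \<open>x\<close> tends to infinity.
\<close>

section \<open>Power series converging on the unit disc\<close>

definition conv_unit_disc :: "(nat \<Rightarrow> real) \<Rightarrow> bool" where
  "conv_unit_disc a \<longleftrightarrow> (\<forall>y. \<bar>y\<bar> < 1 \<longrightarrow> summable (\<lambda>k. a k * y ^ k))"

definition qseries :: "real \<Rightarrow> (nat \<Rightarrow> real) \<Rightarrow> real \<Rightarrow> real" where
  "qseries q a x = (\<Sum>k. a k * (q powr x) ^ k)"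

lemma conv_unit_discD: "conv_unit_disc a \<Longrightarrow> \<bar>y\<bar> < 1 \<Longrightarrow> summable (\<lambda>k. a k * y ^ k)"
  by (simp add: conv_unit_disc_def)

lemma conv_unit_disc_bounded:
  assumes "\<And>k. \<bar>a k\<bar> \<le> B"
  shows "conv_unit_disc a"
  unfolding conv_unit_disc_def
proof (intro allI impI)
  fix y :: real assume y: "\<bar>y\<bar> < 1"
  have "summable (\<lambda>k. B * \<bar>y\<bar> ^ k)"
    using y by (intro summable_mult summable_geometric) auto
  moreover have "norm (a k * y ^ k) \<le> B * \<bar>y\<bar> ^ k" for k
    using assms[of k] by (simp add: abs_mult power_abs mult_right_mono)
  ultimately show "summable (\<lambda>k. a k * y ^ k)"
    by (rule summable_comparison_test'[where N = 0])
qed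

lemma conv_unit_disc_add:
  "conv_unit_disc a \<Longrightarrow> conv_unit_disc b \<Longrightarrow> conv_unit_disc (\<lambda>k. a k + b k)"
  by (auto simp: conv_unit_disc_def distrib_right intro: summable_add)

lemma conv_unit_disc_mult: "conv_unit_disc a \<Longrightarrow> conv_unit_disc (\<lambda>k. r * a k)"
  by (auto simp: conv_unit_disc_def mult.assoc intro: summable_mult)

text \<open>Serves the shift from \<open>x\<close> to \<open>x + c\<close>, which multiplies
  \<open>y = q powr x\<close> by \<open>q powr c\<close>.\<close>

lemma conv_unit_disc_scale:
  assumes "conv_unit_disc a" "0 \<le> r" "r \<le> 1"
  shows "conv_unit_disc (\<lambda>k. a k * r ^ k)"
  unfolding conv_unit_disc_def
proof (intro allI impI)
  fix y :: real assume "\<bar>y\<bar> < 1"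
  then have "\<bar>r * y\<bar> < 1"
    using assms(2,3) mult_left_le_one_le[of "\<bar>y\<bar>" r] by (simp add: abs_mult)
  from conv_unit_discD[OF assms(1) this] show "summable (\<lambda>k. a k * r ^ k * y ^ k)"
    by (simp add: power_mult_distrib mult.assoc)
qed

lemma DERIV_power_series_unit_disc:
  assumes "conv_unit_disc a" "\<bar>y\<bar> < 1"
  shows "((\<lambda>z. \<Sum>k. a k * z ^ k) has_real_derivative (\<Sum>k. diffs a k * y ^ k)) (at y)"
  by (rule termdiffs_strong'[where K = 1]) (use assms in \<open>auto simp: conv_unit_disc_def\<close>)

text \<open>Multiplying by \<open>y\<close> undoes the index shift in \<open>diffs\<close>. The
  factor \<open>y\<close> is supplied by the chain rule, since \<open>q powr x\<close> has
  derivative \<open>q powr x * ln q\<close>.\<close>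

lemma euler_operator_sums:
  assumes "conv_unit_disc a" "\<bar>y\<bar> < 1"
  shows "(\<lambda>k. real k * a k * y ^ k) sums (y * (\<Sum>k. diffs a k * y ^ k))"
proof -
  have "summable (\<lambda>k. diffs a k * y ^ k)"
    by (rule termdiff_converges[where K = 1]) (use assms in \<open>auto simp: conv_unit_disc_def\<close>)
  from sums_mult[OF diffs_equiv[OF this], of y]
  have "(\<lambda>k. y * (real k * a k * y ^ (k - Suc 0))) sums (y * (\<Sum>k. diffs a k * y ^ k))" .
  \<comment> \<open>The truncated exponent at \<open>k = 0\<close> is harmless because of the factor
    \<open>real k\<close>.\<close>
  moreover have "y * (real k * a k * y ^ (k - Suc 0)) = real k * a k * y ^ k" for k
    by (cases k) auto
  ultimately show ?thesis by simp
qed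

lemma conv_unit_disc_euler:
  "conv_unit_disc a \<Longrightarrow> conv_unit_disc (\<lambda>k. real k * a k)"
  using euler_operator_sums sums_summable unfolding conv_unit_disc_def by blast

text \<open>The closed forms below are valid for positive arguments only; as the half-line is open,
  this is enough to transfer derivatives.\<close>

lemma has_derivative_cong_pos:
  fixes f :: "real \<Rightarrow> real"
  assumes "\<And>x. 0 < x \<Longrightarrow> f x = h x" "(h has_real_derivative D) (at x)" "0 < x"
  shows "(f has_real_derivative D) (at x)"
  by (rule has_field_derivative_transform_within_open[OF assms(2), of "{0<..}"])
    (use assms in auto)

context
  fixes q :: real
  assumes q: "0 < q" "q < 1"
begin

lemma powr_unit: "0 < x \<Longrightarrow> \<bar>q powr x\<bar> < 1"
  using q powr_less_mono'[of q 0 x] by auto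

section \<open>Series in powers of \<open>q powr x\<close>: derivatives and sign\<close>

lemma has_derivative_qseries:
  assumes "conv_unit_disc a" "0 < x"
  shows "(qseries q a has_real_derivative ln q * qseries q (\<lambda>k. real k * a k) x) (at x)"
proof -
  note y = powr_unit[OF assms(2)]
  have "((\<lambda>x. q powr x) has_real_derivative q powr x * ln q) (at x)"
    using q by (auto intro!: derivative_eq_intros)
  from DERIV_chain2[OF DERIV_power_series_unit_disc[OF assms(1) y] this]
  show ?thesis
    using sums_unique[OF euler_operator_sums[OF assms(1) y]]
    unfolding qseries_def by (simp add: mult_ac)
qed

lemma completely_monotonic_qseries:
  assumes f: "\<And>x. 0 < x \<Longrightarrow> f x = qseries q a x"
    and conv: "conv_unit_disc a" and nonneg: "\<And>k. 0 \<le> a k"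
  shows "completely_monotonic_on {0<..} f"
proof -
  have conv': "conv_unit_disc (\<lambda>k. (ln q * real k) ^ n * a k)" for n
  proof (induction n)
    case (Suc n)
    from conv_unit_disc_mult[OF conv_unit_disc_euler[OF this], of "ln q"]
    show ?case by (simp add: mult_ac)
  qed (simp add: conv)
  have D: "(qseries q (\<lambda>k. (ln q * real k) ^ n * a k) has_real_derivative
      qseries q (\<lambda>k. (ln q * real k) ^ Suc n * a k) x) (at x)" if "0 < x" for n x
  proof -
    have "ln q * qseries q (\<lambda>k. real k * ((ln q * real k) ^ n * a k)) x
        = qseries q (\<lambda>k. (ln q * real k) ^ Suc n * a k) x"
      unfolding qseries_def
      by (subst suminf_mult[symmetric])
        (use conv_unit_discD[OF conv_unit_disc_euler[OF conv'[of n]] powr_unit[OF that]]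
          in \<open>simp_all add: mult_ac\<close>)
    with has_derivative_qseries[OF conv' that] show ?thesis by metis
  qed
  have iter: "(deriv ^^ n) f x = qseries q (\<lambda>k. (ln q * real k) ^ n * a k) x" if "0 < x" for n x
    using that
  proof (induction n arbitrary: x)
    case (Suc n)
    show ?case
      using DERIV_imp_deriv[OF has_derivative_cong_pos[OF Suc.IH D[OF Suc.prems] Suc.prems]]
      by simp
  qed (simp add: f)
  have "0 \<le> (- 1) ^ n * qseries q (\<lambda>k. (ln q * real k) ^ n * a k) x" if "0 < x" for n x
  proof -
    have sm: "summable (\<lambda>k. (ln q * real k) ^ n * a k * (q powr x) ^ k)"
      by (rule conv_unit_discD[OF conv' powr_unit[OF that]])
    \<comment> \<open>The alternating sign is absorbed into the power: \<open>- ln q\<close> is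
      positive, so every term becomes nonnegative.\<close>
    have "(- 1) ^ n * ((ln q * real k) ^ n * a k * (q powr x) ^ k)
        = (- ln q * real k) ^ n * a k * (q powr x) ^ k" for k
      by (simp add: power_minus[of "ln q * real k"])
    moreover have "0 \<le> (- ln q * real k) ^ n * a k * (q powr x) ^ k" for k
      using q nonneg by (intro mult_nonneg_nonneg zero_le_power) auto
    ultimately have "0 \<le> (- 1) ^ n * ((ln q * real k) ^ n * a k * (q powr x) ^ k)" for k
      by metis
    then show ?thesis
      unfolding qseries_def suminf_mult[OF sm, symmetric]
      by (intro suminf_nonneg summable_mult sm) auto
  qed
  moreover have "(deriv ^^ n) f differentiable (at x)" if "0 < x" for n x
    using has_derivative_cong_pos[OF iter D[OF that] that] real_differentiable_def by blast
  ultimately show ?thesis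
    by (simp add: completely_monotonic_on_def iter)
qed

text \<open>As a function of \<open>y\<close> the series vanishes at 0 with slope
  \<open>a 1\<close>, so it is negative for small positive \<open>y\<close>, that is, for large
  \<open>x\<close>.\<close>

lemma qseries_neg_of_leading_coeff:
  assumes "conv_unit_disc a" "a 0 = 0" "a 1 < 0"
  shows "\<exists>x>0. qseries q a x < 0"
proof -
  let ?G = "\<lambda>z. \<Sum>k. a k * z ^ k"
  have "(?G has_real_derivative a 1) (at 0)"
    using DERIV_power_series_unit_disc[OF assms(1), of 0]
    by (simp add: powser_zero diffs_def)
  from DERIV_neg_dec_right[OF this assms(3)]
  obtain d where d: "d > 0" "\<And>h. 0 < h \<Longrightarrow> h < d \<Longrightarrow> ?G h < ?G 0" by auto
  \<comment> \<open>\<open>d / 2\<close> keeps \<open>y\<close> strictly below \<open>d\<close>;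
    \<open>1 / 2\<close> keeps it below 1, so that \<open>log q y\<close> is positive.\<close>
  define y where "y = min (d / 2) (1 / 2)"
  have y: "0 < y" "y < d" "y < 1" using d(1) by (auto simp: y_def)
  have "?G y < 0" using d(2)[OF y(1,2)] assms(2) by (simp add: powser_zero)
  moreover have "q powr (log q y) = y" using q y by simp
  moreover have "0 < log q y" using q y by (simp add: log_def divide_neg_neg)
  ultimately show ?thesis
    unfolding qseries_def by metis
qed

section \<open>Series for the q-gamma and q-digamma functions\<close>

text \<open>At \<open>k = 0\<close> the coefficients \<open>1 / k\<close> and \<open>lcoef k\<close> have the junk value \<open>0\<close>,
  which is the intended constant term.\<close>

definition lcoef :: "nat \<Rightarrow> real" where
  "lcoef k = 1 / (real k * (1 - q ^ k))"

lemma one_minus_power_ge: "0 < k \<Longrightarrow> 1 - q \<le> 1 - q ^ k"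
  using q power_decreasing[of 1 k q] by auto

lemma conv_inverse: "conv_unit_disc (\<lambda>k. 1 / real k)"
proof (rule conv_unit_disc_bounded[where B = 1])
  show "\<bar>1 / real k\<bar> \<le> 1" for k by (cases k) auto
qed

lemma conv_lcoef: "conv_unit_disc lcoef"
proof (rule conv_unit_disc_bounded[where B = "1 / (1 - q)"])
  fix k
  show "\<bar>lcoef k\<bar> \<le> 1 / (1 - q)"
  proof (cases "k = 0")
    case False
    then have "1 * (1 - q) \<le> real k * (1 - q ^ k)"
      using q one_minus_power_ge[of k] by (intro mult_mono) auto
    then show ?thesis
      using q by (simp add: lcoef_def frac_le)
  qed (use q in \<open>simp add: lcoef_def\<close>)
qed

lemma ln_one_minus_sums:
  assumes "\<bar>y\<bar> < 1"
  shows "(\<lambda>k. 1 / real k * y ^ k) sums (- ln (1 - y))"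
  using sums_minus[OF ln_series'[of "- y"]] assms by simp

text \<open>The logarithm of the product is found from its functional equation under
  \<open>y \<mapsto> q y\<close>, which makes the partial products telescope.\<close>

lemma qpochhammer_inf_eq_exp:
  assumes "\<bar>y\<bar> < 1"
  shows "qpochhammer_inf y q = exp (- (\<Sum>k. lcoef k * y ^ k))"
proof -
  define L where "L z = (\<Sum>k. lcoef k * z ^ k)" for z
  have func: "L z - L (q * z) = - ln (1 - z)" if "\<bar>z\<bar> < 1" for z
  proof -
    have qz: "\<bar>q * z\<bar> < 1"
      using that q mult_left_le_one_le[of "\<bar>z\<bar>" q] by (simp add: abs_mult)
    have "lcoef k * z ^ k - lcoef k * (q * z) ^ k = 1 / real k * z ^ k" for k
    proof (cases "k = 0")
      case False
      then have "1 - q ^ k \<noteq> 0" using one_minus_power_ge[of k] q by auto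
      moreover have "lcoef k * z ^ k - lcoef k * (q * z) ^ k = lcoef k * (1 - q ^ k) * z ^ k"
        by (simp add: power_mult_distrib algebra_simps)
      ultimately show ?thesis by (simp add: lcoef_def)
    qed (simp add: lcoef_def)
    then have "L z - L (q * z) = (\<Sum>k. 1 / real k * z ^ k)"
      unfolding L_def
      by (subst suminf_diff) (simp_all add: conv_unit_discD[OF conv_lcoef] that qz)
    then show ?thesis using sums_unique[OF ln_one_minus_sums[OF that]] by simp
  qed
  have unit: "\<bar>y * q ^ n\<bar> < 1" for n
    using assms q mult_right_le_one_le[of "\<bar>y\<bar>" "q ^ n"] by (simp add: abs_mult power_le_one)
  have part: "(\<Prod>n<N. 1 - y * q ^ n) = exp (L (y * q ^ N) - L y)" for N
  proof (induction N)
    case (Suc N)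
    have "L (y * q ^ Suc N) - L (y * q ^ N) = ln (1 - y * q ^ N)"
      using func[OF unit[of N]] by (simp add: mult_ac)
    then have "1 - y * q ^ N = exp (L (y * q ^ Suc N) - L (y * q ^ N))"
      using unit[of N] by simp
    then show ?case using Suc by (simp add: exp_diff)
  qed simp
  \<comment> \<open>The telescoped product involves \<open>L (y * q ^ N)\<close>, whose limit is
    \<open>L 0 = 0\<close> by continuity.\<close>
  have "isCont L 0"
    unfolding L_def using DERIV_isCont[OF DERIV_power_series_unit_disc[OF conv_lcoef, of 0]] by simp
  moreover have "(\<lambda>N. y * q ^ N) \<longlonglongrightarrow> 0"
    using q by (intro tendsto_mult_right_zero LIMSEQ_realpow_zero) auto
  ultimately have "(\<lambda>N. L (y * q ^ N)) \<longlonglongrightarrow> L 0" by (rule isCont_tendsto_compose)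
  moreover have "L 0 = 0" by (simp only: L_def powser_zero) (simp add: lcoef_def)
  ultimately have "(\<lambda>N. \<Prod>n<N. 1 - y * q ^ n) \<longlonglongrightarrow> exp (0 - L y)"
    unfolding part by (intro tendsto_intros) simp
  \<comment> \<open>\<open>raw_has_prod\<close> takes partial products up to and including
    \<open>N\<close>, and needs a nonzero limit, here an exponential.\<close>
  then have "(\<lambda>N. \<Prod>n\<le>N. 1 - y * q ^ n) \<longlonglongrightarrow> exp (- L y)"
    unfolding lessThan_Suc_atMost[symmetric] using LIMSEQ_Suc by force
  then have "raw_has_prod (\<lambda>n. 1 - y * q ^ n) 0 (exp (- L y))"
    by (simp add: raw_has_prod_def)
  then have "(\<lambda>n. 1 - y * q ^ n) has_prod exp (- L y)"
    by (simp add: has_prod_def)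
  then show ?thesis
    unfolding qpochhammer_inf_def L_def by (simp add: has_prod_unique[symmetric])
qed

text \<open>The exponential form turns the logarithmic derivative into the derivative of the
  exponent, in which the sum coming from \<open>qpochhammer_inf q q\<close> is constant.\<close>

lemma qGamma_eq_exp:
  assumes "0 < x"
  shows "qGamma q x = exp (qseries q lcoef x - (\<Sum>k. lcoef k * q ^ k) + (1 - x) * ln (1 - q))"
  using q powr_unit[OF assms]
  by (simp add: qGamma_def qpochhammer_inf_eq_exp qseries_def powr_def[of "1 - q"]
      exp_add exp_diff exp_minus field_simps)

lemma qDigamma_eq:
  assumes "0 < x"
  shows "qDigamma q x = ln q * qseries q (\<lambda>k. real k * lcoef k) x - ln (1 - q)"
proof -
  let ?E = "\<lambda>x. exp (qseries q lcoef x - (\<Sum>k. lcoef k * q ^ k) + (1 - x) * ln (1 - q))"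
  have "(?E has_real_derivative
      ?E x * (ln q * qseries q (\<lambda>k. real k * lcoef k) x - ln (1 - q))) (at x)"
    by (auto intro!: derivative_eq_intros has_derivative_qseries[OF conv_lcoef assms])
  from DERIV_imp_deriv[OF has_derivative_cong_pos[OF qGamma_eq_exp this assms]]
  show ?thesis
    unfolding qDigamma_def qGamma_eq_exp[OF assms] by simp
qed

lemma deriv_qDigamma_eq:
  assumes "0 < x"
  shows "deriv (qDigamma q) x = (ln q)\<^sup>2 * qseries q (\<lambda>k. (real k)\<^sup>2 * lcoef k) x"
proof (rule DERIV_imp_deriv, rule has_derivative_cong_pos[OF qDigamma_eq _ assms])
  show "((\<lambda>x. ln q * qseries q (\<lambda>k. real k * lcoef k) x - ln (1 - q)) has_real_derivative
      (ln q)\<^sup>2 * qseries q (\<lambda>k. (real k)\<^sup>2 * lcoef k) x) (at x)"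
    by (auto intro!: derivative_eq_intros
        has_derivative_qseries[OF conv_unit_disc_euler[OF conv_lcoef] assms]
        simp: power2_eq_square mult.assoc)
qed

section \<open>The function \<open>gq\<close> as a series\<close>

text \<open>The three summands come from \<open>- ln (1 - q powr x)\<close>, from
  \<open>qDigamma\<close>, and from its shifted derivative, with
  \<open>aq q * (ln q)\<^sup>2 = q - 1 - ln q\<close>.\<close>

definition gcoef :: "real \<Rightarrow> nat \<Rightarrow> real" where
  "gcoef c k = 1 / real k + ln q * (real k * lcoef k)
     + (q - 1 - ln q) * ((real k)\<^sup>2 * lcoef k * (q powr c) ^ k)"

lemma conv_gcoef_summands:
  assumes "0 \<le> c"
  shows "conv_unit_disc (\<lambda>k. real k * lcoef k)"
    and "conv_unit_disc (\<lambda>k. (real k)\<^sup>2 * lcoef k)"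
    and "conv_unit_disc (\<lambda>k. (real k)\<^sup>2 * lcoef k * (q powr c) ^ k)"
proof -
  show 1: "conv_unit_disc (\<lambda>k. real k * lcoef k)"
    by (rule conv_unit_disc_euler[OF conv_lcoef])
  show 2: "conv_unit_disc (\<lambda>k. (real k)\<^sup>2 * lcoef k)"
    using conv_unit_disc_euler[OF 1] by (simp add: power2_eq_square mult.assoc)
  show "conv_unit_disc (\<lambda>k. (real k)\<^sup>2 * lcoef k * (q powr c) ^ k)"
    using q assms powr_le_one_le[of q] powr_mono'[of 0 c q]
    by (intro conv_unit_disc_scale[OF 2]) auto
qed

lemma conv_gcoef: "0 \<le> c \<Longrightarrow> conv_unit_disc (gcoef c)"
  unfolding gcoef_def
  by (intro conv_unit_disc_add conv_unit_disc_mult conv_inverse conv_gcoef_summands)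

lemma gq_eq_qseries:
  assumes "0 \<le> c" "0 < x"
  shows "gq q c x = qseries q (gcoef c) x"
proof -
  note y = powr_unit[OF assms(2)]
  have "0 < x + c" using assms by simp
  define S1 S2 where "S1 = qseries q (\<lambda>k. real k * lcoef k) x"
    and "S2 = qseries q (\<lambda>k. (real k)\<^sup>2 * lcoef k) (x + c)"
  have s1: "(\<lambda>k. real k * lcoef k * (q powr x) ^ k) sums S1"
    unfolding S1_def qseries_def
    by (intro summable_sums conv_unit_discD[OF conv_gcoef_summands(1)[OF assms(1)] y])
  have s2: "(\<lambda>k. (real k)\<^sup>2 * lcoef k * (q powr (x + c)) ^ k) sums S2"
    unfolding S2_def qseries_def
    by (intro summable_sums conv_unit_discD[OF conv_gcoef_summands(2)[OF assms(1)]
          powr_unit[OF \<open>0 < x + c\<close>]])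
  have "gcoef c k * (q powr x) ^ k = 1 / real k * (q powr x) ^ k
      + ln q * (real k * lcoef k * (q powr x) ^ k)
      + (q - 1 - ln q) * ((real k)\<^sup>2 * lcoef k * (q powr (x + c)) ^ k)" for k
    by (simp add: gcoef_def powr_add power_mult_distrib algebra_simps)
  with sums_add[OF sums_add[OF ln_one_minus_sums[OF y] sums_mult[OF s1, of "ln q"]]
      sums_mult[OF s2, of "q - 1 - ln q"]]
  have "qseries q (gcoef c) x = - ln (1 - q powr x) + ln q * S1 + (q - 1 - ln q) * S2"
    unfolding qseries_def by (simp add: sums_iff)
  \<comment> \<open>The term \<open>- ln (1 - q)\<close> of \<open>qDigamma\<close> cancels against
    the denominator of the logarithm, so no constant term remains.\<close>
  moreover have "gq q c x = - ln (1 - q powr x) + ln q * S1 + aq q * ((ln q)\<^sup>2 * S2)"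
    using q y assms(2) by (simp add: gq_def qDigamma_eq[OF assms(2)] deriv_qDigamma_eq[OF \<open>0 < x + c\<close>]
        S1_def S2_def ln_div)
  moreover have "aq q * (ln q)\<^sup>2 = q - 1 - ln q"
    using q by (simp add: aq_def)
  ultimately show ?thesis by (simp flip: mult.assoc)
qed

section \<open>Signs of the coefficients\<close>

lemma minus_ln_ge: "(1 - q) + (1 - q)\<^sup>2 / 2 \<le> - ln q"
proof -
  have s: "(\<lambda>k. 1 / real k * (1 - q) ^ k) sums (- ln q)"
    using ln_one_minus_sums[of "1 - q"] q by simp
  \<comment> \<open>All terms are nonnegative; the range contains the zero term \<open>k = 0\<close>
    and the linear and quadratic terms.\<close>
  have "(\<Sum>k<3. 1 / real k * (1 - q) ^ k) \<le> - ln q"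
    unfolding sums_unique[OF s] using q by (intro sum_le_suminf sums_summable[OF s]) auto
  then show ?thesis by (simp add: eval_nat_numeral)
qed

text \<open>From \<open>k\<close> to \<open>k + 1\<close> the left side grows by
  \<open>(q - 1 - ln q) + (1 - q) * (1 - q ^ k)\<close> and the right side by
  \<open>(2 * k + 1) * (q - 1 - ln q)\<close>. Bernoulli's inequality and \<open>minus_ln_ge\<close>
  compare the two.\<close>

lemma power_minus_one_plus_linear_le:
  "q ^ k - 1 - real k * ln q \<le> (real k)\<^sup>2 * (q - 1 - ln q)"
proof (induction k)
  case (Suc k)
  have "1 - real k * (1 - q) \<le> q ^ k"
    using Bernoulli_inequality[of "q - 1" k] q by (simp add: algebra_simps)
  then have "(1 - q) * (1 - q ^ k) \<le> (1 - q) * (real k * (1 - q))"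
    using q by (intro mult_left_mono) auto
  also have "\<dots> = real k * (1 - q)\<^sup>2" by (simp add: power2_eq_square)
  also have "\<dots> \<le> real k * (2 * (q - 1 - ln q))"
    using minus_ln_ge by (intro mult_left_mono) (auto simp: power2_eq_square)
  finally have "(1 - q) * (1 - q ^ k) \<le> real k * (2 * (q - 1 - ln q))" .
  then show ?case using Suc by (simp add: power2_eq_square algebra_simps)
qed simp

lemma gcoef_zero_nonneg: "0 \<le> gcoef 0 k"
proof (cases "k = 0")
  case False
  then have p: "0 < 1 - q ^ k" using one_minus_power_ge[of k] q by auto
  have "gcoef 0 k = lcoef k * ((real k)\<^sup>2 * (q - 1 - ln q) - (q ^ k - 1 - real k * ln q))"
  proof -
    have "real k * lcoef k * (1 - q ^ k) = 1" using False p by (simp add: lcoef_def)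
    then have "1 / real k = lcoef k * (1 - q ^ k)" using False by (simp add: field_simps)
    then show ?thesis using q by (simp add: gcoef_def algebra_simps)
  qed
  moreover have "0 \<le> lcoef k" using p by (simp add: lcoef_def)
  ultimately show ?thesis using power_minus_one_plus_linear_le[of k] by simp
qed (simp add: gcoef_def lcoef_def)

text \<open>The constant \<open>aq q\<close> makes this coefficient vanish for \<open>c = 0\<close>;
  a positive \<open>c\<close> shrinks its last, positive summand by the factor
  \<open>q powr c\<close>.\<close>

lemma gcoef_one_neg:
  assumes "0 < c"
  shows "gcoef c 1 < 0"
proof -
  have "gcoef c 1 = (q - 1 - ln q) * (q powr c - 1) / (1 - q)"
  proof -
    have "lcoef 1 * (1 - q) = 1" using q by (simp add: lcoef_def)
    then have "gcoef c 1 = lcoef 1 * (1 - q) + ln q * lcoef 1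
        + (q - 1 - ln q) * (lcoef 1 * q powr c)"
      by (simp add: gcoef_def)
    also have "\<dots> = (q - 1 - ln q) * (q powr c - 1) * lcoef 1"
      by (simp add: algebra_simps)
    finally show ?thesis by (simp add: lcoef_def)
  qed
  moreover have "0 < (1 - q)\<^sup>2" using q by simp
  then have "0 < q - 1 - ln q" using minus_ln_ge by linarith
  moreover have "q powr c < 1" using powr_unit[OF assms] by simp
  ultimately show ?thesis using q by (simp add: divide_neg_pos mult_pos_neg)
qed

end

theorem theorem3p3:
  fixes q c :: real
  assumes "0 < q" and "q < 1" and "c \<ge> 0"
  shows "completely_monotonic_on {0<..} (gq q c) \<longleftrightarrow> c = 0"
proof
  note q = assms(1,2)
  assume cm: "completely_monotonic_on {0<..} (gq q c)"
  show "c = 0"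
  proof (rule ccontr)
    assume "c \<noteq> 0"
    then have "gcoef q c 1 < 0" using gcoef_one_neg[OF q] assms(3) by simp
    moreover have "gcoef q c 0 = 0" by (simp add: gcoef_def[OF q] lcoef_def[OF q])
    ultimately obtain x where "0 < x" "qseries q (gcoef q c) x < 0"
      using qseries_neg_of_leading_coeff[OF q conv_gcoef[OF q assms(3)]] by blast
    then have "gq q c x < 0" using gq_eq_qseries[OF q assms(3)] by simp
    \<comment> \<open>Complete monotonicity already fails at order 0.\<close>
    moreover have "0 \<le> (- 1) ^ 0 * (deriv ^^ 0) (gq q c) x"
      using cm \<open>0 < x\<close> unfolding completely_monotonic_on_def by blast
    ultimately show False by simp
  qed
next
  note q = assms(1,2)
  assume "c = 0"
  then show "completely_monotonic_on {0<..} (gq q c)"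
    using completely_monotonic_qseries[OF q gq_eq_qseries[OF q] conv_gcoef[OF q]
        gcoef_zero_nonneg[OF q]] by simp
qed

end
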